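(* For every integer $t\geq 3$ there exists a constant $C_t$ such that for every positive integer $n$, $$\mathrm{ex}(n,H_t)\leq C_t\, n^{1+\frac{t-2}{2t-3}}=C_t\, n^{3/2-\frac{1}{4t-6}}.$$
   Context: For a graph $H$, $\mathrm{ex}(n,H)$ denotes the maximum number of edges in an $n$-vertex graph containing no subgraph isomorphic to $H$. The subdivision of a graph $L$ is the bipartite graph with parts $V(L)$ and $E(L)$ in which $v\in V(L)$ is adjacent to $e\in E(L)$ if and only if $v$ is an endpoint of $e$. $H_t$ denotes the subdivision of the complete graph $K_t$. *)

theory Defs
  imports Complex_Main
begin

type_synonym 'a graph = "'a set \<times> 'a set set"

definition simple_graph :: "'a graph \<Rightarrow> bool" where
  "simple_graph G \<longleftrightarrow> finite (fst G) \<and>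
     (\<forall>e\<in>snd G. \<exists>u v. u \<in> fst G \<and> v \<in> fst G \<and> u \<noteq> v \<and> e = {u, v})"

definition contains_subgraph :: "'a graph \<Rightarrow> 'b graph \<Rightarrow> bool" where
  "contains_subgraph G H \<longleftrightarrow>
     (\<exists>\<phi>. inj_on \<phi> (fst H) \<and> \<phi> ` fst H \<subseteq> fst G \<and> (\<forall>e\<in>snd H. \<phi> ` e \<in> snd G))"

definition ex :: "nat \<Rightarrow> 'b graph \<Rightarrow> nat" where
  "ex n H = Max {card (snd G) | G :: nat graph.
              fst G = {0..<n} \<and> simple_graph G \<and> \<not> contains_subgraph G H}"

definition subdivision :: "'a graph \<Rightarrow> ('a + 'a set) graph" where
  "subdivision L = (Inl ` fst L \<union> Inr ` snd L,
                    {{Inl v, Inr e} | v e. v \<in> fst L \<and> e \<in> snd L \<and> v \<in> e})"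

definition complete_graph :: "nat \<Rightarrow> nat graph" where
  "complete_graph t = ({0..<t}, {{i, j} | i j. i < t \<and> j < t \<and> i \<noteq> j})"

definition H :: "nat \<Rightarrow> (nat + nat set) graph" where
  "H t = subdivision (complete_graph t)"

end

theory Submission
  imports Defs "HOL-Analysis.Convex"
begin

text \<open>
  After Janzer. Call a pair of vertices heavy if it has at least $t^2$ common neighbours, and light
  if it has some but fewer. A heavy clique on $t$ vertices yields $H_t$ by choosing the midpoints
  greedily, so in an $H_t$-free graph Turan's theorem, applied inside each neighbourhood, forces
  every not too small set $U$ to contain a vertex $u$ with about $(d^2/m)|U|$ light neighbours in
  $U$, where $m$ is the number of vertices and $d$ the typical degree. One then picks vertices
  $u_1, \dots, u_t$ one at a time, keeping a set $U$ of candidates that are light to all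
  chosen vertices. As light pairs have few common neighbours and degrees are $O(d)$,
  it costs only $O(d)$ candidates per step to ensure that no vertex is adjacent to three of the
  $u_i$, so that midpoints chosen for different pairs differ. The process survives
  because $d^{2t-3}$ is large compared with $m^{t-2}$, and this is where the exponent comes from.
  The chosen vertices are also kept independent, which separates them from the midpoints and makes
  it unnecessary to pass to a bipartite subgraph.

  The degree condition is obtained by passing to the vertex set that maximises
  $e(S)/|S|^{1+\alpha}$ and deleting its vertices of high degree.
\<close>

section \<open>Heavy, light and spread: relations between vertices inside a set
  \<open>A\<close>\<close>

definition common_nbrs :: "'a set set \<Rightarrow> 'a set \<Rightarrow> 'a \<Rightarrow> 'a \<Rightarrow> 'a set" where
  "common_nbrs E A u v = {b \<in> A. {u, b} \<in> E \<and> {v, b} \<in> E}"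

definition heavy :: "'a set set \<Rightarrow> 'a set \<Rightarrow> nat \<Rightarrow> 'a \<Rightarrow> 'a \<Rightarrow> bool" where
  "heavy E A q u v \<longleftrightarrow> u \<noteq> v \<and> q \<le> card (common_nbrs E A u v)"

definition light :: "'a set set \<Rightarrow> 'a set \<Rightarrow> nat \<Rightarrow> 'a \<Rightarrow> 'a \<Rightarrow> bool" where
  "light E A q u v \<longleftrightarrow>
     u \<noteq> v \<and> common_nbrs E A u v \<noteq> {} \<and> card (common_nbrs E A u v) < q"

definition spread :: "'a set set \<Rightarrow> 'a set \<Rightarrow> nat \<Rightarrow> 'a set \<Rightarrow> bool" where
  "spread E A q T \<longleftrightarrow>
     (\<forall>u\<in>T. \<forall>v\<in>T. u \<noteq> v \<longrightarrow> light E A q u v \<and> {u, v} \<notin> E) \<and>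
     (\<forall>b\<in>A. card {u \<in> T. {u, b} \<in> E} \<le> 2)"

text \<open>Pairs are ordered, so the cardinality is a degree sum: an edge between two distinct
  vertices of \<open>X\<close> counts twice, and a singleton in \<open>E\<close> would act as a
  loop.\<close>

definition adj_pairs :: "'a set set \<Rightarrow> 'a set \<Rightarrow> ('a \<times> 'a) set" where
  "adj_pairs E X = {(u, v). u \<in> X \<and> v \<in> X \<and> {u, v} \<in> E}"

lemma common_nbrs_commute: "common_nbrs E A u v = common_nbrs E A v u"
  by (auto simp: common_nbrs_def)

lemma finite_common_nbrs: "finite A \<Longrightarrow> finite (common_nbrs E A u v)"
  by (auto simp: common_nbrs_def)

lemma light_commute: "light E A q u v \<longleftrightarrow> light E A q v u"
  by (auto simp: light_def common_nbrs_commute)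

section \<open>Finding \<open>H t\<close> in heavy cliques and in spread sets\<close>

lemma card_pairs_le:
  assumes "finite T"
  shows "card {{u, v} | u v. u \<in> T \<and> v \<in> T \<and> u \<noteq> v} \<le> card T * card T - card T"
proof -
  have "{{u, v} | u v. u \<in> T \<and> v \<in> T \<and> u \<noteq> v} = (\<lambda>(u, v). {u, v}) ` (T \<times> T - Id_on T)"
    by auto
  also have "card \<dots> \<le> card (T \<times> T - Id_on T)"
    using assms by (intro card_image_le) auto
  also have "\<dots> = card (T \<times> T) - card (Id_on T)"
    using assms by (intro card_Diff_subset) (auto simp: Id_on_def)
  also have "card (Id_on T) = card T"
  proof -
    have "Id_on T = (\<lambda>x. (x, x)) ` T" by (auto simp: Id_on_def)
    then show ?thesis by (simp add: card_image inj_on_def)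
  qed
  finally show ?thesis by (simp add: card_cartesian_product)
qed

text \<open>An enumeration \<open>h\<close> sends the branch vertices to \<open>T\<close>, and the
  subdivision vertex of an edge goes to the midpoint of the image pair. Midpoints avoid
  \<open>T\<close>, so only two midpoints could collide, which \<open>inj\<close> rules out.\<close>

lemma contains_H:
  fixes V T :: "'a set"
  assumes "finite T" "card T = t" "T \<subseteq> V"
    and inj: "inj_on \<mu> {{u, v} | u v. u \<in> T \<and> v \<in> T \<and> u \<noteq> v}"
    and \<mu>: "\<And>u v. u \<in> T \<Longrightarrow> v \<in> T \<Longrightarrow> u \<noteq> v \<Longrightarrow> \<mu> {u, v} \<in> V - T \<and> {u, \<mu> {u, v}} \<in> E"
  shows "contains_subgraph (V, E) (H t)"
proof -
  obtain h where h: "bij_betw h {0..<t} T"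
    using ex_bij_betw_nat_finite[OF assms(1)] assms(2) by auto
  have hT: "h i \<in> T" if "i < t" for i using h that by (auto simp: bij_betw_def)
  have hinj: "h i = h j \<longleftrightarrow> i = j" if "i < t" "j < t" for i j
    using h that by (auto simp: bij_betw_def inj_on_def)
  define \<phi> where "\<phi> = case_sum h (\<lambda>e. \<mu> (h ` e))"
  let ?F = "{{i, j} | i j. i < t \<and> j < t \<and> i \<noteq> j}"
  let ?P = "{{u, v} | u v. u \<in> T \<and> v \<in> T \<and> u \<noteq> v}"
  have img: "h ` e \<in> ?P" if "e \<in> ?F" for e
  proof -
    from that obtain i j where e: "e = {i, j}" "i < t" "j < t" "i \<noteq> j" by auto
    show ?thesis unfolding e(1) using hT[OF e(2)] hT[OF e(3)] hinj[OF e(2,3)] e(4) by auto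
  qed
  have out: "\<mu> p \<in> V - T" if "p \<in> ?P" for p using that \<mu> by blast
  have inj\<phi>: "inj_on \<phi> (Inl ` {0..<t} \<union> Inr ` ?F)"
  proof (rule inj_onI)
    fix x y assume x: "x \<in> Inl ` {0..<t} \<union> Inr ` ?F" and y: "y \<in> Inl ` {0..<t} \<union> Inr ` ?F"
      and eq: "\<phi> x = \<phi> y"
    have ll: "e = e'" if e: "e \<in> ?F" and e': "e' \<in> ?F" and "\<mu> (h ` e) = \<mu> (h ` e')" for e e'
    proof -
      have "h ` e = h ` e'" using inj_onD[OF inj that(3)] img[OF e] img[OF e'] by blast
      moreover have "e \<subseteq> {0..<t}" "e' \<subseteq> {0..<t}" using e e' by auto
      ultimately show ?thesis using h by (metis bij_betw_def inj_on_image_eq_iff)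
    qed
    have lr: "h i \<noteq> \<mu> (h ` e)" if "i < t" "e \<in> ?F" for i e
      using out[OF img[OF that(2)]] hT[OF that(1)] by auto
    from x consider (a) i where "x = Inl i" "i < t" | (b) e where "x = Inr e" "e \<in> ?F" by auto
    then show "x = y"
    proof cases
      case a
      from y consider (c) i where "y = Inl i" "i < t" | (d) e where "y = Inr e" "e \<in> ?F" by auto
      then show ?thesis using a eq hinj lr by cases (auto simp: \<phi>_def)
    next
      case b
      from y consider (c) i where "y = Inl i" "i < t" | (d) e where "y = Inr e" "e \<in> ?F" by auto
      then show ?thesis
      proof cases
        case c then show ?thesis using b eq lr[of i e] by (simp add: \<phi>_def)
      next
        case d then show ?thesis using b eq ll[OF b(2) d(2)] by (simp add: \<phi>_def)
      qed
    qed
  qed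
  have img\<phi>: "\<phi> ` (Inl ` {0..<t} \<union> Inr ` ?F) \<subseteq> V"
  proof (rule image_subsetI)
    fix x assume "x \<in> Inl ` {0..<t} \<union> Inr ` ?F"
    then consider (a) i where "x = Inl i" "i < t" | (b) e where "x = Inr e" "e \<in> ?F" by auto
    then show "\<phi> x \<in> V"
    proof cases
      case a
      then show ?thesis using hT[of i] assms(3) by (auto simp: \<phi>_def)
    next
      case b
      then show ?thesis using out[OF img[OF b(2)]] by (simp add: \<phi>_def)
    qed
  qed
  have edge: "\<phi> ` {Inl i, Inr e} \<in> E" if i: "i < t" and eF: "e \<in> ?F" and ie: "i \<in> e" for i e
  proof -
    obtain a b where ab: "e = {a, b}" "a < t" "b < t" "a \<noteq> b" using eF by auto
    define j where "j = (if i = a then b else a)"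
    have e: "e = {i, j}" "j < t" "i \<noteq> j" using ab ie by (auto simp: j_def)
    have "{h i, \<mu> {h i, h j}} \<in> E"
      using \<mu> hT hinj i e by blast
    then show ?thesis by (simp add: \<phi>_def e(1))
  qed
  show ?thesis
    unfolding contains_subgraph_def H_def subdivision_def complete_graph_def fst_conv snd_conv
  proof (intro exI conjI ballI)
    fix x assume "x \<in> {{Inl v, Inr e} | v e. v \<in> {0..<t} \<and> e \<in> ?F \<and> v \<in> e}"
    then obtain v e where x: "x = {Inl v, Inr e}" and "v < t" "e \<in> ?F" "v \<in> e" by auto
    then show "\<phi> ` x \<in> E" unfolding x by (intro edge)
  qed (fact inj\<phi> img\<phi>)+
qed

text \<open>Greedy choice: fewer than \<open>n\<close> values are taken before each step, so each
  set still offers a fresh element.\<close>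

lemma distinct_representatives:
  assumes "finite I" "\<And>i. i \<in> I \<Longrightarrow> n \<le> card (F i)" "card I \<le> n"
  shows "\<exists>f. inj_on f I \<and> (\<forall>i\<in>I. f i \<in> F i)"
  using assms
proof (induction I rule: finite_induct)
  case empty
  then show ?case by auto
next
  case (insert i I)
  then obtain f where f: "inj_on f I" "\<forall>i\<in>I. f i \<in> F i" by auto
  have "card (f ` I) < card (F i)"
    using insert card_image_le[of I f] by (smt (verit) card_insert_disjoint insertI1 le_trans not_less_eq_eq not_le)
  then have "\<not> F i \<subseteq> f ` I" using insert(1) card_mono[of "f ` I" "F i"] by fastforce
  then obtain y where y: "y \<in> F i" "y \<notin> f ` I" by auto
  have eq: "(f(i := y)) ` I = f ` I" using insert(2) by auto
  have "inj_on (f(i := y)) I" using f(1) insert(2) by (auto simp: inj_on_def)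
  then have "inj_on (f(i := y)) (insert i I)"
    using y(2) insert(2) eq by (auto simp: inj_on_insert)
  moreover have "\<forall>j\<in>insert i I. (f(i := y)) j \<in> F j" using f y by auto
  ultimately show ?case by blast
qed

text \<open>This explains the threshold \<open>t ^ 2\<close>: removing the \<open>t\<close> clique
  vertices from a common neighbourhood leaves at least \<open>t ^ 2 - t\<close> candidates, which is
  the bound of \<open>card_pairs_le\<close> on the number of midpoints to be chosen.\<close>

lemma contains_H_if_heavy_clique:
  assumes "finite A" "A \<subseteq> V" "T \<subseteq> A" "card T = t"
    and heavy: "\<And>u v. u \<in> T \<Longrightarrow> v \<in> T \<Longrightarrow> u \<noteq> v \<Longrightarrow> heavy E A (t ^ 2) u v"
  shows "contains_subgraph (V, E) (H t)"
proof -
  let ?P = "{{u, v} | u v. u \<in> T \<and> v \<in> T \<and> u \<noteq> v}"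
  define F where "F e = {b \<in> A. \<forall>u\<in>e. {u, b} \<in> E} - T" for e
  have finT: "finite T" using assms finite_subset by blast
  have finP: "finite ?P" by (rule finite_subset[of _ "Pow T"]) (use finT in auto)
  have "t ^ 2 - t \<le> card (F e)" if "e \<in> ?P" for e
  proof -
    from that obtain u v where uv: "e = {u, v}" "u \<in> T" "v \<in> T" "u \<noteq> v" by auto
    have "F e = common_nbrs E A u v - T" by (auto simp: F_def uv(1) common_nbrs_def)
    moreover have "t ^ 2 \<le> card (common_nbrs E A u v)" using heavy[OF uv(2-4)] by (simp add: heavy_def)
    ultimately show ?thesis using diff_card_le_card_Diff[OF finT, of "common_nbrs E A u v"] assms(4)
      by (metis diff_le_mono le_trans)
  qed
  moreover have "card ?P \<le> t ^ 2 - t"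
    using card_pairs_le[OF finT] assms(4) by (simp add: power2_eq_square)
  ultimately have "\<exists>f. inj_on f ?P \<and> (\<forall>e\<in>?P. f e \<in> F e)"
    by (rule distinct_representatives[OF finP])
  then obtain f where f: "inj_on f ?P" "\<forall>e\<in>?P. f e \<in> F e" by blast
  show ?thesis
  proof (rule contains_H[OF finT assms(4) _ f(1)])
    show "T \<subseteq> V" using assms by auto
    fix u v assume "u \<in> T" "v \<in> T" "u \<noteq> v"
    then have "{u, v} \<in> ?P" by blast
    then have "f {u, v} \<in> F {u, v}" using f(2) by blast
    then show "f {u, v} \<in> V - T \<and> {u, f {u, v}} \<in> E" using assms(2) by (auto simp: F_def)
  qed
qed

text \<open>Arbitrary common neighbours serve as midpoints: two distinct pairs together contain at
  least three vertices of \<open>T\<close>, and a shared midpoint would be adjacent to all of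
  them.\<close>

lemma contains_H_if_spread:
  assumes "finite A" "A \<subseteq> V" "T \<subseteq> A" "card T = t" and spread: "spread E A q T"
  shows "contains_subgraph (V, E) (H t)"
proof -
  let ?P = "{{u, v} | u v. u \<in> T \<and> v \<in> T \<and> u \<noteq> v}"
  have finT: "finite T" using assms finite_subset by blast
  define \<mu> where "\<mu> e = (SOME b. b \<in> A \<and> (\<forall>u\<in>e. {u, b} \<in> E))" for e
  have \<mu>: "\<mu> e \<in> A \<and> (\<forall>u\<in>e. {u, \<mu> e} \<in> E)" if "e \<in> ?P" for e
  proof -
    from that obtain u v where uv: "e = {u, v}" "u \<in> T" "v \<in> T" "u \<noteq> v" by auto
    then have "common_nbrs E A u v \<noteq> {}" using spread by (auto simp: spread_def light_def)
    then have "\<exists>b. b \<in> A \<and> (\<forall>u\<in>e. {u, b} \<in> E)" by (auto simp: uv(1) common_nbrs_def)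
    then show ?thesis unfolding \<mu>_def by (rule someI_ex)
  qed
  have "inj_on \<mu> ?P"
  proof (rule inj_onI)
    fix e e' assume e: "e \<in> ?P" and e': "e' \<in> ?P" and eq: "\<mu> e = \<mu> e'"
    show "e = e'"
    proof (rule ccontr)
      assume "e \<noteq> e'"
      have c: "card e = 2" "card e' = 2" "e \<union> e' \<subseteq> T" using e e' by auto
      then have fin: "finite (e \<union> e')" using finT finite_subset by blast
      have "\<not> e' \<subseteq> e" using c \<open>e \<noteq> e'\<close> card_subset_eq[of e e'] fin by auto
      then have "e \<subset> e \<union> e'" by auto
      then have "2 < card (e \<union> e')" using psubset_card_mono[OF fin, of e] c by auto
      also have "\<dots> \<le> card {u \<in> T. {u, \<mu> e} \<in> E}"
        using \<mu>[OF e] \<mu>[OF e'] c eq finT by (intro card_mono) auto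
      also have "\<dots> \<le> 2" using spread \<mu>[OF e] by (auto simp: spread_def)
      finally show False by simp
    qed
  qed
  then show ?thesis
  proof (rule contains_H[OF finT assms(4) subset_trans[OF assms(3,2)]])
    fix u v assume uv: "u \<in> T" "v \<in> T" "u \<noteq> v"
    then have "{u, v} \<in> ?P" by blast
    note m = \<mu>[OF this]
    \<comment> \<open>A midpoint in \<open>T\<close> is adjacent to \<open>u\<close> and
      \<open>v\<close>, so independence of \<open>T\<close> would force it to equal both.\<close>
    have "\<mu> {u, v} \<notin> T"
    proof
      assume "\<mu> {u, v} \<in> T"
      then have "\<mu> {u, v} = w" if "w \<in> {u, v}" for w
        using m spread uv that unfolding spread_def by (metis insertE singletonD)
      then show False using uv by (metis insertI1 insert_commute)
    qed
    then show "\<mu> {u, v} \<in> V - T \<and> {u, \<mu> {u, v}} \<in> E" using m assms(2) by auto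
  qed
qed

section \<open>Turan's theorem and vertices with many light neighbours\<close>

text \<open>Induction on \<open>r\<close> via a vertex \<open>u\<close> of maximum degree: cliques
  in \<open>N u\<close> have at most \<open>r\<close> vertices, and each vertex outside
  \<open>N u\<close> has at least \<open>card (X - N u)\<close> non-neighbours. Diagonal pairs count
  as non-adjacent, which gives the bound its clean form.\<close>

lemma turan_non_adjacent_pairs:
  fixes R :: "'a \<Rightarrow> 'a \<Rightarrow> bool"
  assumes "finite X" "\<And>x y. R x y \<Longrightarrow> R y x" "\<And>x. \<not> R x x"
    and "\<And>T. T \<subseteq> X \<Longrightarrow> (\<And>x y. x \<in> T \<Longrightarrow> y \<in> T \<Longrightarrow> x \<noteq> y \<Longrightarrow> R x y) \<Longrightarrow> card T \<le> r"
  shows "(real (card X))\<^sup>2 \<le> real r * real (card {(x, y). x \<in> X \<and> y \<in> X \<and> \<not> R x y})"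
  using assms(1,4)
proof (induction r arbitrary: X)
  case 0
  have "card X = 0"
  proof (rule ccontr)
    assume "card X \<noteq> 0"
    then obtain x where "x \<in> X" by fastforce
    then have "card {x} \<le> 0" by (intro 0(2)) auto
    then show False by simp
  qed
  then show ?case by simp
next
  case (Suc r)
  show ?case
  proof (cases "X = {}")
    case True
    then show ?thesis by simp
  next
    case False
    define N where "N x = {y \<in> X. R x y}" for x
    obtain u where u: "u \<in> X" and umax: "\<And>x. x \<in> X \<Longrightarrow> card (N x) \<le> card (N u)"
      using arg_min_if_finite(1)[OF Suc.prems(1) False, of "\<lambda>x. - int (card (N x))"]
        arg_min_least[OF Suc.prems(1) False, of _ "\<lambda>x. - int (card (N x))"] by fastforce
    have finN: "finite (N u)" and NX: "N u \<subseteq> X" using Suc.prems by (auto simp: N_def)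
    have cl: "card T \<le> r" if T: "T \<subseteq> N u" "\<And>x y. x \<in> T \<Longrightarrow> y \<in> T \<Longrightarrow> x \<noteq> y \<Longrightarrow> R x y" for T
    proof -
      have "u \<notin> T" using T assms(3) by (auto simp: N_def)
      moreover have "finite T" using T finN finite_subset by blast
      moreover have "card (insert u T) \<le> Suc r"
        using T u assms(2) by (intro Suc.prems(2)) (auto simp: N_def)
      ultimately show ?thesis by simp
    qed
    let ?P = "\<lambda>X. {(x, y). x \<in> X \<and> y \<in> X \<and> \<not> R x y}"
    let ?S = "Sigma (X - N u) (\<lambda>x. X - N x)"
    have finP: "finite (?P X)" by (rule finite_subset[of _ "X \<times> X"]) (use Suc.prems in auto)
    have "card (X - N u) * card (X - N u) \<le> (\<Sum>x\<in>X - N u. card (X - N x))"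
    proof -
      have "card (X - N u) \<le> card (X - N x)" if "x \<in> X - N u" for x
        using umax[of x] that Suc.prems(1) finN NX
        by (subst (1 2) card_Diff_subset) (auto simp: N_def)
      then have "(\<Sum>x\<in>X - N u. card (X - N u)) \<le> (\<Sum>x\<in>X - N u. card (X - N x))"
        by (rule sum_mono)
      then show ?thesis by simp
    qed
    also have "\<dots> = card ?S" using Suc.prems by (subst card_SigmaI) auto
    finally have "card (X - N u) * card (X - N u) + card (?P (N u)) \<le> card ?S + card (?P (N u))" by simp
    \<comment> \<open>The first coordinates lie outside \<open>N u\<close> in \<open>?S\<close> and
      inside it in the other set.\<close>
    also have "\<dots> = card (?S \<union> ?P (N u))"
      using finP Suc.prems(1) NX
      by (intro card_Un_disjoint[symmetric]) (auto intro: finite_subset[of _ "?P X"] simp: N_def)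
    also have "\<dots> \<le> card (?P X)"
      using NX by (intro card_mono finP) (auto simp: N_def)
    finally have 1: "card (X - N u) * card (X - N u) + card (?P (N u)) \<le> card (?P X)" .
    define a b p where "a = real (card (X - N u))" and "b = real (card (N u))"
      and "p = real (card (?P (N u)))"
    have ab: "real (card X) = a + b"
      using Suc.prems NX finN card_mono[of X "N u"] by (simp add: a_def b_def card_Diff_subset)
    have IH: "b\<^sup>2 \<le> r * p" unfolding b_def p_def by (rule Suc.IH[OF finN cl])
    have "0 \<le> a" "0 \<le> b" "0 \<le> p" by (simp_all add: a_def b_def p_def)
    \<comment> \<open>The AM-GM inequality for \<open>r * a\<^sup>2\<close> and \<open>p\<close>,
      combined with \<open>IH\<close>. Working with squares avoids a division by \<open>r\<close>,
      which may be 0 here.\<close>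
    have "(2 * a * b)\<^sup>2 \<le> (r * a\<^sup>2 + p)\<^sup>2"
    proof -
      have "(2 * a * b)\<^sup>2 = 4 * a\<^sup>2 * b\<^sup>2" by (simp add: power_mult_distrib)
      also have "\<dots> \<le> 4 * a\<^sup>2 * (r * p)" using IH by (intro mult_left_mono) auto
      also have "\<dots> \<le> (r * a\<^sup>2 + p)\<^sup>2"
        using zero_le_power2[of "r * a\<^sup>2 - p"] by (simp add: power2_eq_square algebra_simps)
      finally show ?thesis .
    qed
    then have "2 * a * b \<le> r * a\<^sup>2 + p"
      by (rule power2_le_imp_le) (use \<open>0 \<le> p\<close> in auto)
    then have "(a + b)\<^sup>2 \<le> Suc r * (a * a + p)"
      using IH by (simp add: power2_eq_square algebra_simps)
    also have "\<dots> \<le> Suc r * real (card (?P X))"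
      using 1 unfolding a_def p_def by (intro mult_left_mono) (simp_all flip: of_nat_mult of_nat_add)
    finally show ?thesis by (simp add: ab)
  qed
qed

text \<open>Double counting of light pairs together with a common neighbour \<open>b\<close>:
  Turan's theorem gives many such pairs in each \<open>N b\<close>, Cauchy-Schwarz bounds the sum
  over \<open>b\<close> from below, and each light pair is counted fewer than \<open>q\<close>
  times. An average over \<open>U\<close> then yields \<open>u\<close>.\<close>

lemma ex_many_light:
  fixes d :: real
  assumes "finite A" "U \<subseteq> A" "U \<noteq> {}" "1 \<le> r" "0 < d"
    and deg: "\<And>u. u \<in> U \<Longrightarrow> d \<le> card {b \<in> A. {u, b} \<in> E}"
    and clique: "\<And>T. T \<subseteq> U \<Longrightarrow> (\<And>x y. x \<in> T \<Longrightarrow> y \<in> T \<Longrightarrow> x \<noteq> y \<Longrightarrow> heavy E A q x y)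
      \<Longrightarrow> card T \<le> r"
    and large: "2 * real r * real (card A) \<le> d * card U"
  shows "\<exists>u\<in>U. d\<^sup>2 * card U \<le> 2 * real r * real q * real (card A) * real (card {v \<in> U. light E A q u v})"
proof -
  have finU: "finite U" using assms finite_subset by blast
  define N where "N b = {u \<in> U. {u, b} \<in> E}" for b
  define L where "L = {(u, v). u \<in> U \<and> v \<in> U \<and> light E A q u v}"
  define M where "M = (\<Sum>b\<in>A. real (card (N b)))"
  have finN: "finite (N b)" for b using finU by (simp add: N_def)
  have finL: "finite L" by (rule finite_subset[of _ "U \<times> U"]) (use finU in \<open>auto simp: L_def\<close>)
  have "d * card U \<le> (\<Sum>u\<in>U. real (card {b \<in> A. {u, b} \<in> E}))"
    using sum_mono[of U "\<lambda>_. d", OF deg] by (simp add: mult.commute)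
  also have "\<dots> = M"
    unfolding M_def N_def using sum.swap_restrict[OF finU assms(1), of "\<lambda>_ _. 1::real" "\<lambda>u b. {u, b} \<in> E"]
    by simp
  finally have dM: "d * card U \<le> M" .
  let ?O = "\<lambda>b. {p \<in> L. b \<in> common_nbrs E A (fst p) (snd p)}"
  have "(real (card (N b)))\<^sup>2 \<le> r * (real (card (?O b)) + card (N b))" if b: "b \<in> A" for b
  proof -
    let ?P = "{(x, y). x \<in> N b \<and> y \<in> N b \<and> \<not> heavy E A q x y}"
    \<comment> \<open>Two distinct vertices of \<open>N b\<close> have the common neighbour
      \<open>b\<close>, so if they are not heavy they are light.\<close>
    have "?P \<subseteq> ?O b \<union> (\<lambda>x. (x, x)) ` N b"
      using b by (auto simp: N_def L_def light_def heavy_def common_nbrs_def)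
    then have "card ?P \<le> card (?O b \<union> (\<lambda>x. (x, x)) ` N b)"
      using finL finN by (intro card_mono) auto
    also have "\<dots> \<le> card (?O b) + card (N b)"
      using card_Un_le card_image_le[OF finN] by (meson add_left_mono le_trans)
    finally have 1: "real (card ?P) \<le> real (card (?O b)) + card (N b)" by linarith
    have "(real (card (N b)))\<^sup>2 \<le> r * real (card ?P)"
    proof (rule turan_non_adjacent_pairs[OF finN])
      show "card T \<le> r" if "T \<subseteq> N b" "\<And>x y. x \<in> T \<Longrightarrow> y \<in> T \<Longrightarrow> x \<noteq> y \<Longrightarrow> heavy E A q x y" for T
        using that by (intro clique) (auto simp: N_def)
    qed (auto simp: heavy_def common_nbrs_commute)
    also have "\<dots> \<le> r * (real (card (?O b)) + card (N b))"
      using 1 by (intro mult_left_mono) auto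
    finally show ?thesis .
  qed
  then have "(\<Sum>b\<in>A. (real (card (N b)))\<^sup>2) \<le> (\<Sum>b\<in>A. r * (real (card (?O b)) + card (N b)))"
    by (rule sum_mono)
  also have "\<dots> = r * ((\<Sum>b\<in>A. real (card (?O b))) + M)"
    by (simp add: M_def flip: sum_distrib_left sum.distrib)
  also have "(\<Sum>b\<in>A. real (card (?O b))) = (\<Sum>p\<in>L. real (card {b \<in> A. b \<in> common_nbrs E A (fst p) (snd p)}))"
    using sum.swap_restrict[OF assms(1) finL, of "\<lambda>_ _. 1::real" "\<lambda>b p. b \<in> common_nbrs E A (fst p) (snd p)"]
    by simp
  also have "\<dots> \<le> (\<Sum>p\<in>L. real q)"
    by (intro sum_mono) (auto simp: L_def light_def common_nbrs_def)
  finally have sq: "(\<Sum>b\<in>A. (real (card (N b)))\<^sup>2) \<le> r * (q * real (card L) + M)"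
    by (simp add: mult_left_mono mult.commute)
  have "M\<^sup>2 \<le> card A * (\<Sum>b\<in>A. (real (card (N b)))\<^sup>2)"
    unfolding M_def using sum_squared_le_sum_of_squares[of "\<lambda>b. real (card (N b))" A]
    by (simp add: mult.commute)
  also have "\<dots> \<le> card A * (r * (q * real (card L) + M))"
    using sq by (rule mult_left_mono) simp
  finally have M2: "M\<^sup>2 \<le> real (card A) * real r * real q * real (card L) + (r * real (card A)) * M"
    by (simp add: algebra_simps)
  have "0 < d * card U" using assms finU by (simp add: card_gt_0_iff)
  then have "0 < M" using dM by linarith
  \<comment> \<open>By \<open>large\<close>, the contribution of the diagonal pairs is at most half
    of \<open>M\<^sup>2\<close> and can be absorbed on the left.\<close>
  have "2 * ((r * real (card A)) * M) \<le> M * M"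
    using mult_right_mono[of "2 * (r * real (card A))" M M] large dM \<open>0 < M\<close> by simp
  then have "M\<^sup>2 \<le> 2 * (real (card A) * real r * real q * real (card L))"
    using M2 by (simp add: power2_eq_square)
  moreover have "(d * card U)\<^sup>2 \<le> M\<^sup>2"
    using dM \<open>0 < d * card U\<close> by (intro power_mono) auto
  moreover have "real (card L) = (\<Sum>u\<in>U. real (card {v \<in> U. light E A q u v}))"
  proof -
    have "L = Sigma U (\<lambda>u. {v \<in> U. light E A q u v})" by (auto simp: L_def)
    then show ?thesis using finU by simp
  qed
  ultimately have tot: "(d * card U)\<^sup>2 \<le>
      (\<Sum>u\<in>U. 2 * real r * real q * real (card A) * real (card {v \<in> U. light E A q u v}))"
    by (simp add: sum_distrib_left mult.assoc mult.left_commute)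
  show ?thesis
  proof (rule ccontr)
    assume "\<not> ?thesis"
    then have "(\<Sum>u\<in>U. 2 * real r * real q * real (card A) * real (card {v \<in> U. light E A q u v})) < (\<Sum>u\<in>U. d\<^sup>2 * card U)"
      using finU \<open>U \<noteq> {}\<close> by (intro sum_strict_mono) (auto simp: not_le)
    also have "\<dots> = (d * card U)\<^sup>2" by (simp add: power2_eq_square)
    finally show False using tot by simp
  qed
qed

section \<open>Choosing a spread set one vertex at a time\<close>

text \<open>The invariant of the selection: each single candidate in \<open>U\<close> may join
  \<open>T\<close>. Two candidates need not fit together, so \<open>U\<close> must shrink after
  every choice.\<close>

definition extendable :: "'a set set \<Rightarrow> 'a set \<Rightarrow> nat \<Rightarrow> 'a set \<Rightarrow> 'a set \<Rightarrow> bool" where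
  "extendable E A q T U \<longleftrightarrow>
     finite T \<and> T \<inter> U = {} \<and> spread E A q T \<and> (\<forall>v\<in>U. spread E A q (insert v T))"

text \<open>A vertex \<open>b\<close> that misses \<open>u\<close> or \<open>v\<close> is controlled
  by the spread sets \<open>insert v T\<close> and \<open>insert u T\<close>. If \<open>b\<close> is
  adjacent to both, a further neighbour \<open>w\<close> in \<open>T\<close> would make
  \<open>b\<close> a common neighbour of \<open>w\<close> and \<open>u\<close> adjacent to
  \<open>v\<close>, which the definition of \<open>U'\<close> forbids.\<close>

lemma extendable_insert:
  assumes ext: "extendable E A q T U" and u: "u \<in> U"
    and U': "U' = {v \<in> U. light E A q u v \<and> {u, v} \<notin> E \<and>
                   (\<forall>w\<in>T. \<forall>b\<in>common_nbrs E A w u. {b, v} \<notin> E)}"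
  shows "extendable E A q (insert u T) U'"
proof -
  have finT: "finite T" using ext by (simp add: extendable_def)
  have "spread E A q (insert v (insert u T))" if v: "v \<in> U'" for v
  proof -
    have sv: "spread E A q (insert v T)" and su: "spread E A q (insert u T)"
      using ext u v U' by (auto simp: extendable_def)
    have uv: "light E A q u v" "light E A q v u" "{u, v} \<notin> E" "{v, u} \<notin> E"
      using v U' by (auto simp: light_commute insert_commute)
    have "card {x \<in> insert v (insert u T). {x, b} \<in> E} \<le> 2" if b: "b \<in> A" for b
    proof (cases "{u, b} \<in> E \<and> {v, b} \<in> E")
      case True
      then have "{x \<in> insert v (insert u T). {x, b} \<in> E} \<subseteq> {u, v}"
        using v b U' by (auto simp: common_nbrs_def insert_commute)
      then have "card {x \<in> insert v (insert u T). {x, b} \<in> E} \<le> card {u, v}"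
        by (intro card_mono) auto
      also have "\<dots> \<le> 2" by (simp add: card_insert_if)
      finally show ?thesis .
    next
      case False
      then have "{x \<in> insert v (insert u T). {x, b} \<in> E} \<subseteq> {x \<in> insert u T. {x, b} \<in> E} \<or>
          {x \<in> insert v (insert u T). {x, b} \<in> E} \<subseteq> {x \<in> insert v T. {x, b} \<in> E}" by auto
      then have "card {x \<in> insert v (insert u T). {x, b} \<in> E} \<le> card {x \<in> insert u T. {x, b} \<in> E} \<or>
          card {x \<in> insert v (insert u T). {x, b} \<in> E} \<le> card {x \<in> insert v T. {x, b} \<in> E}"
        by (rule disj_forward) (use finT in \<open>simp_all add: card_mono\<close>)
      moreover have "card {x \<in> insert u T. {x, b} \<in> E} \<le> 2" "card {x \<in> insert v T. {x, b} \<in> E} \<le> 2"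
        using sv su b unfolding spread_def by blast+
      ultimately show ?thesis by linarith
    qed
    then show ?thesis using sv su uv unfolding spread_def by blast
  qed
  moreover have "u \<notin> U'" using U' by (auto simp: light_def)
  ultimately show ?thesis using ext u U' by (auto simp: extendable_def)
qed

text \<open>Two kinds of candidates are lost: neighbours of \<open>u\<close>, and neighbours of the
  common neighbours of \<open>u\<close> with some \<open>w\<close> in \<open>T\<close>. For each
  \<open>w\<close> there are fewer than \<open>q\<close> such common neighbours, because a candidate
  \<open>u\<close> is light to all of \<open>T\<close>.\<close>

lemma prune_light_nbrs:
  fixes \<Delta> :: real
  assumes "finite A" "U \<subseteq> A" "u \<in> U" and ext: "extendable E A q T U"
    and deg: "\<And>a. a \<in> A \<Longrightarrow> card {b \<in> A. {a, b} \<in> E} \<le> \<Delta>"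
  shows "card {v \<in> U. light E A q u v} - (1 + card T * q) * \<Delta> \<le>
    card {v \<in> U. light E A q u v \<and> {u, v} \<notin> E \<and> (\<forall>w\<in>T. \<forall>b\<in>common_nbrs E A w u. {b, v} \<notin> E)}"
    (is "_ \<le> real (card ?U')")
proof -
  let ?N = "\<lambda>a. {b \<in> A. {a, b} \<in> E}"
  have finT: "finite T" using ext by (simp add: extendable_def)
  have finU: "finite U" using assms finite_subset by blast
  have "0 \<le> \<Delta>" using deg[of u] assms by (meson in_mono of_nat_0_le_iff order_trans)
  have bd: "real (card (\<Union>b\<in>common_nbrs E A w u. ?N b)) \<le> q * \<Delta>" if w: "w \<in> T" for w
  proof -
    have "spread E A q (insert u T)" "u \<notin> T" using ext assms(3) by (auto simp: extendable_def)
    then have "light E A q w u" using w by (auto simp: spread_def)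
    then have c: "card (common_nbrs E A w u) \<le> q" by (simp add: light_def)
    have "real (card (\<Union>b\<in>common_nbrs E A w u. ?N b)) \<le> (\<Sum>b\<in>common_nbrs E A w u. real (card (?N b)))"
      using card_UN_le[OF finite_common_nbrs[OF assms(1)], of ?N E w u] by (simp flip: of_nat_sum)
    also have "\<dots> \<le> (\<Sum>b\<in>common_nbrs E A w u. \<Delta>)"
      by (intro sum_mono deg) (simp add: common_nbrs_def)
    also have "\<dots> \<le> q * \<Delta>" using c \<open>0 \<le> \<Delta>\<close> by (simp add: mult_right_mono)
    finally show ?thesis .
  qed
  let ?X = "\<Union>w\<in>T. \<Union>b\<in>common_nbrs E A w u. ?N b"
  have "real (card ?X) \<le> (\<Sum>w\<in>T. real (card (\<Union>b\<in>common_nbrs E A w u. ?N b)))"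
    using card_UN_le[OF finT, of "\<lambda>w. \<Union>b\<in>common_nbrs E A w u. ?N b"] by (simp flip: of_nat_sum)
  also have "\<dots> \<le> (\<Sum>w\<in>T. q * \<Delta>)" by (intro sum_mono bd)
  finally have X: "real (card ?X) \<le> card T * (q * \<Delta>)" by simp
  have "{v \<in> U. light E A q u v} \<subseteq> ?U' \<union> (?N u \<union> ?X)"
    using assms(2) by auto
  then have "card {v \<in> U. light E A q u v} \<le> card (?U' \<union> (?N u \<union> ?X))"
    using finU finT assms(1) by (intro card_mono) (auto intro!: finite_common_nbrs)
  also have "\<dots> \<le> card ?U' + (card (?N u) + card ?X)"
    using card_Un_le by (meson add_left_mono le_trans)
  finally have "real (card {v \<in> U. light E A q u v}) \<le> card ?U' + (real (card (?N u)) + card ?X)"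
    by linarith
  also have "real (card (?N u)) \<le> \<Delta>" using assms by (intro deg) auto
  finally show ?thesis using X by (simp add: algebra_simps)
qed

text \<open>Each choice keeps at least a fraction \<open>\<gamma>\<close> of the candidates:
  \<open>ex_many_light\<close> with \<open>r = t\<close> and \<open>q = t ^ 2\<close> provides a
  fraction \<open>2 * \<gamma>\<close>, and \<open>large\<close> ensures that pruning costs at most
  half of that.\<close>

lemma spread_set_exists:
  fixes d m \<kappa> \<gamma> :: real
  assumes fin: "finite A" "U\<^sub>0 \<subseteq> A" "U\<^sub>0 \<noteq> {}" and "1 \<le> t" "0 < d" "1 \<le> \<kappa>" "card A \<le> m" "0 < m"
    and deg_ge: "\<And>u. u \<in> U\<^sub>0 \<Longrightarrow> d \<le> card {b \<in> A. {u, b} \<in> E}"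
    and deg_le: "\<And>a. a \<in> A \<Longrightarrow> card {b \<in> A. {a, b} \<in> E} \<le> \<kappa> * d"
    and clique: "\<And>T. T \<subseteq> A \<Longrightarrow> (\<And>x y. x \<in> T \<Longrightarrow> y \<in> T \<Longrightarrow> x \<noteq> y \<Longrightarrow> heavy E A (t ^ 2) x y)
      \<Longrightarrow> card T \<le> t"
    and \<gamma>: "\<gamma> = d\<^sup>2 / (4 * real t ^ 3 * m)"
    and large: "\<And>s. s + 2 \<le> t \<Longrightarrow> 4 * real t ^ 6 * \<kappa> * m / d \<le> \<gamma> ^ s * card U\<^sub>0"
  shows "\<exists>T\<subseteq>A. card T = t \<and> spread E A (t ^ 2) T"
proof -
  have "0 < \<gamma>" using \<open>0 < d\<close> \<open>1 \<le> t\<close> \<open>0 < m\<close> by (simp add: \<gamma>)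
  have t1: "1 \<le> real t" using \<open>1 \<le> t\<close> by simp
  have grow: "s + 1 \<le> t \<Longrightarrow> \<exists>T U. T \<subseteq> A \<and> U \<subseteq> U\<^sub>0 \<and> card T = s \<and>
      extendable E A (t ^ 2) T U \<and> \<gamma> ^ s * card U\<^sub>0 \<le> card U" for s
  proof (induction s)
    case 0
    have "card {u. u = v \<and> {u, b} \<in> E} \<le> 2" for v b
    proof -
      have "card {u. u = v \<and> {u, b} \<in> E} \<le> card {v}" by (rule card_mono) auto
      then show ?thesis by simp
    qed
    then have "extendable E A (t ^ 2) {} U\<^sub>0"
      by (auto simp: extendable_def spread_def)
    then show ?case by (intro exI[of _ "{}"] exI[of _ U\<^sub>0]) auto
  next
    case (Suc s)
    then obtain T U where T: "T \<subseteq> A" "card T = s" and U: "U \<subseteq> U\<^sub>0"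
      and ext: "extendable E A (t ^ 2) T U" and sz: "\<gamma> ^ s * card U\<^sub>0 \<le> card U"
      by auto
    have UA: "U \<subseteq> A" using U fin by auto
    have "4 * real t ^ 6 * \<kappa> * m / d \<le> card U" using large[of s] Suc.prems sz by linarith
    then have lg: "4 * real t ^ 6 * \<kappa> * m \<le> d * card U"
      using \<open>0 < d\<close> by (simp add: field_simps)
    \<comment> \<open>The size needed for pruning already exceeds the size that
      \<open>ex_many_light\<close> asks for.\<close>
    have "2 * real t * m \<le> 4 * real t ^ 6 * \<kappa> * m"
    proof -
      have "1 * (real t * 1) \<le> \<kappa> * (real t * real t ^ 5)"
        using t1 \<open>1 \<le> \<kappa>\<close> by (intro mult_mono) (auto intro!: mult_left_mono)
      moreover have "real t ^ 6 = t * real t ^ 5" by (simp add: eval_nat_numeral)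
      moreover have "0 \<le> \<kappa> * (real t * real t ^ 5)" using \<open>1 \<le> \<kappa>\<close> by simp
      ultimately have "2 * real t \<le> 4 * real t ^ 6 * \<kappa>" by (simp add: mult.commute)
      then show ?thesis using \<open>0 < m\<close> by (intro mult_right_mono) auto
    qed
    moreover have "2 * real t * real (card A) \<le> 2 * real t * m"
      using \<open>card A \<le> m\<close> by (intro mult_left_mono) auto
    ultimately have lg2: "2 * real t * real (card A) \<le> d * card U" using lg by linarith
    have "0 < 4 * real t ^ 6 * \<kappa> * m" using \<open>1 \<le> t\<close> \<open>1 \<le> \<kappa>\<close> \<open>0 < m\<close> by simp
    then have "U \<noteq> {}" using lg by auto
    have "\<exists>u\<in>U. d\<^sup>2 * card U \<le> 2 * real t * real (t ^ 2) * real (card A) * real (card {v \<in> U. light E A (t ^ 2) u v})"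
      using clique UA lg2 U
      by (intro ex_many_light fin(1) \<open>U \<noteq> {}\<close> \<open>1 \<le> t\<close> \<open>0 < d\<close> deg_ge) auto
    then obtain u where u: "u \<in> U"
      and *: "d\<^sup>2 * card U \<le> 2 * real t * real (t ^ 2) * real (card A) * real (card {v \<in> U. light E A (t ^ 2) u v})"
      by blast
    define l where "l = real (card {v \<in> U. light E A (t ^ 2) u v})"
    have "d\<^sup>2 * card U \<le> (2 * real t ^ 3 * l) * card A"
      using * by (simp add: l_def power2_eq_square power3_eq_cube mult_ac)
    also have "\<dots> \<le> (2 * real t ^ 3 * l) * m"
      using \<open>card A \<le> m\<close> by (intro mult_left_mono) (auto simp: l_def)
    finally have l1: "2 * (\<gamma> * card U) \<le> l"
      using \<open>0 < m\<close> t1 by (simp add: \<gamma> field_simps)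
    define U' where "U' = {v \<in> U. light E A (t ^ 2) u v \<and> {u, v} \<notin> E \<and>
                   (\<forall>w\<in>T. \<forall>b\<in>common_nbrs E A w u. {b, v} \<notin> E)}"
    have "l - real (1 + card T * t ^ 2) * (\<kappa> * d) \<le> card U'"
      using prune_light_nbrs[OF fin(1) UA u ext deg_le] by (simp add: l_def U'_def)
    moreover have "real (1 + card T * t ^ 2) * (\<kappa> * d) \<le> real t ^ 3 * (\<kappa> * d)"
    proof (rule mult_right_mono)
      have "1 + s * t ^ 2 \<le> t ^ 2 + s * t ^ 2" using \<open>1 \<le> t\<close> by simp
      also have "\<dots> = Suc s * t ^ 2" by simp
      also have "\<dots> \<le> t * t ^ 2" using Suc.prems by (intro mult_right_mono) auto
      finally have "1 + s * t ^ 2 \<le> t ^ 3" by (simp add: power2_eq_square power3_eq_cube)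
      then show "real (1 + card T * t ^ 2) \<le> real t ^ 3"
        unfolding T(2) by (metis of_nat_le_iff of_nat_power)
    qed (use \<open>1 \<le> \<kappa>\<close> \<open>0 < d\<close> in auto)
    \<comment> \<open>Solving this inequality for \<open>card U\<close> gives exactly the threshold
      \<open>4 * real t ^ 6 * \<kappa> * m / d\<close> of \<open>large\<close>.\<close>
    moreover have "real t ^ 3 * (\<kappa> * d) \<le> \<gamma> * card U"
    proof -
      have "d * (4 * real t ^ 6 * \<kappa> * m) \<le> d * (d * card U)"
        using lg \<open>0 < d\<close> by (intro mult_left_mono) auto
      then have "(real t ^ 3 * (\<kappa> * d)) * (4 * real t ^ 3 * m) \<le> d\<^sup>2 * card U"
        by (simp add: power2_eq_square eval_nat_numeral mult_ac)
      then show ?thesis using \<open>0 < m\<close> t1 by (simp add: \<gamma> pos_le_divide_eq)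
    qed
    ultimately have "\<gamma> * card U \<le> card U'" using l1 by linarith
    moreover have "\<gamma> * (\<gamma> ^ s * card U\<^sub>0) \<le> \<gamma> * card U"
      using sz \<open>0 < \<gamma>\<close> by (intro mult_left_mono) auto
    ultimately have "\<gamma> ^ Suc s * card U\<^sub>0 \<le> card U'" by (simp add: mult.assoc)
    moreover have "extendable E A (t ^ 2) (insert u T) U'"
      by (rule extendable_insert[OF ext u U'_def])
    moreover have "card (insert u T) = Suc s"
      using ext u T(2) by (auto simp: extendable_def card_insert_if)
    ultimately show ?case using T U UA u
      by (intro exI[of _ "insert u T"] exI[of _ U']) (auto simp: U'_def)
  qed
  obtain T U where T: "T \<subseteq> A" "card T = t - 1" and U: "U \<subseteq> U\<^sub>0"
      and ext: "extendable E A (t ^ 2) T U" and sz: "\<gamma> ^ (t - 1) * card U\<^sub>0 \<le> card U"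
    using grow[of "t - 1"] \<open>1 \<le> t\<close> by auto
  \<comment> \<open>The last vertex may be any surviving candidate, so \<open>large\<close> is only
    required up to \<open>s = t - 2\<close>.\<close>
  have "0 < \<gamma> ^ (t - 1) * card U\<^sub>0"
    using \<open>0 < \<gamma>\<close> fin finite_subset[of U\<^sub>0 A] by (simp add: card_gt_0_iff)
  then have "U \<noteq> {}" using sz by auto
  then obtain u where "u \<in> U" by auto
  then show ?thesis using T U ext fin \<open>1 \<le> t\<close>
    by (intro exI[of _ "insert u T"]) (auto simp: extendable_def card_insert_if)
qed

section \<open>Passing to an almost regular part of a dense graph\<close>

lemma card_adj_pairs:
  assumes "finite X"
  shows "card (adj_pairs E X) = (\<Sum>u\<in>X. card {v \<in> X. {u, v} \<in> E})"
proof -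
  have "adj_pairs E X = Sigma X (\<lambda>u. {v \<in> X. {u, v} \<in> E})" by (auto simp: adj_pairs_def)
  then show ?thesis using assms by simp
qed

lemma finite_adj_pairs: "finite X \<Longrightarrow> finite (adj_pairs E X)"
  by (rule finite_subset[of _ "X \<times> X"]) (auto simp: adj_pairs_def)

lemma card_adj_pairs_le: "finite X \<Longrightarrow> card (adj_pairs E X) \<le> card X * card X"
  using card_mono[of "X \<times> X" "adj_pairs E X"] by (auto simp: adj_pairs_def card_cartesian_product)

text \<open>Number the elements and group them by residue modulo \<open>k\<close>; within a group
  the quotient by \<open>k\<close> determines the element.\<close>

lemma equipartition:
  assumes "finite S" "0 < (k::nat)"
  shows "\<exists>f. (\<forall>v\<in>S. f v < k) \<and> (\<forall>i<k. card {v \<in> S. f v = i} \<le> card S div k + 1)"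
proof -
  obtain h where h: "bij_betw h S {0..<card S}"
    using ex_bij_betw_finite_nat[OF assms(1)] by auto
  have "card {v \<in> S. h v mod k = i} \<le> card S div k + 1" if "i < k" for i
  proof -
    have "inj_on (\<lambda>v. h v div k) {v \<in> S. h v mod k = i}"
    proof (rule inj_onI)
      fix x y assume "x \<in> {v \<in> S. h v mod k = i}" "y \<in> {v \<in> S. h v mod k = i}" "h x div k = h y div k"
      then have "h x = h y" "x \<in> S" "y \<in> S" by (auto, metis div_mult_mod_eq)
      then show "x = y" using h by (auto simp: bij_betw_def inj_on_def)
    qed
    moreover have "(\<lambda>v. h v div k) ` {v \<in> S. h v mod k = i} \<subseteq> {..card S div k}"
    proof (rule image_subsetI)
      fix v assume "v \<in> {v \<in> S. h v mod k = i}"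
      then have "h v < card S" using h by (force simp: bij_betw_def)
      then show "h v div k \<in> {..card S div k}" by (simp add: div_le_mono)
    qed
    ultimately have "card {v \<in> S. h v mod k = i} \<le> card {..card S div k}"
      using card_inj_on_le by blast
    then show ?thesis by simp
  qed
  then show ?thesis using assms(2) by (intro exI[of _ "\<lambda>v. h v mod k"]) auto
qed

text \<open>\<open>S\<close> maximises the density \<open>\<rho>\<close>, \<open>D\<close> is its
  average degree, and \<open>A\<close> omits the set \<open>B\<close> of vertices of degree above
  \<open>k * D\<close>. Vertices of low degree stay in \<open>A\<close>, since deleting them would
  lower other degrees; only \<open>U\<close> gets the lower bound. Here \<open>m\<close> is the size
  of \<open>S\<close>, not of \<open>A\<close>.\<close>

lemma almost_regular_part:
  fixes \<alpha> c :: real and k :: nat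
  assumes fin: "finite V" and "V \<noteq> {}" and \<alpha>: "0 < \<alpha>" "\<alpha> \<le> 1"
    and k: "1 \<le> k" "36 \<le> real k powr \<alpha>" "real k \<le> c"
    and dense: "c * real (card V) powr (1 + \<alpha>) \<le> card (adj_pairs E V)"
  obtains A U and m d :: real where "A \<subseteq> V" "U \<subseteq> A" "1 \<le> m" "c / 2 * m powr \<alpha> \<le> d"
    "card A \<le> m" "m \<le> 4 * real k * card U"
    "\<forall>a\<in>A. card {b \<in> A. {a, b} \<in> E} \<le> 2 * real k * d"
    "\<forall>u\<in>U. d \<le> card {b \<in> A. {u, b} \<in> E}"
proof -
  define \<rho> where "\<rho> X = card (adj_pairs E X) / real (card X) powr (1 + \<alpha>)" for X
  have "finite {X. X \<subseteq> V \<and> X \<noteq> {}}" "{X. X \<subseteq> V \<and> X \<noteq> {}} \<noteq> {}"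
    using fin \<open>V \<noteq> {}\<close> by auto
  note am = arg_min_if_finite(1)[OF this] arg_min_least[OF this]
  define S where "S = arg_min_on (\<lambda>X. - \<rho> X) {X. X \<subseteq> V \<and> X \<noteq> {}}"
  have S: "S \<subseteq> V" "S \<noteq> {}" using am(1)[of "\<lambda>X. - \<rho> X"] by (simp_all add: S_def)
  have Smax: "\<rho> X \<le> \<rho> S" if "X \<subseteq> V" "X \<noteq> {}" for X
    using am(2)[of X "\<lambda>X. - \<rho> X"] that by (simp add: S_def)
  have finS: "finite S" using S fin finite_subset by blast
  define m where "m = real (card S)"
  define D where "D = card (adj_pairs E S) / m"
  have m1: "1 \<le> m" using S finS by (simp add: m_def Suc_le_eq card_gt_0_iff)
  have cS: "c \<le> \<rho> S"
  proof -
    have "c \<le> \<rho> V" using dense fin \<open>V \<noteq> {}\<close> by (simp add: \<rho>_def pos_le_divide_eq card_gt_0_iff)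
    also have "\<dots> \<le> \<rho> S" using \<open>V \<noteq> {}\<close> by (intro Smax) auto
    finally show ?thesis .
  qed
  have c1: "1 \<le> c" using k by linarith
  have pS: "card (adj_pairs E S) = \<rho> S * m powr (1 + \<alpha>)"
    using m1 by (simp add: \<rho>_def m_def[symmetric])
  have D: "D = \<rho> S * m powr \<alpha>" using m1 by (simp add: D_def pS powr_add)
  have "0 < D" using cS c1 m1 by (simp add: D)
  have pD: "card (adj_pairs E S) = D * m" using m1 by (simp add: D_def)
  have p_le: "card (adj_pairs E X) \<le> \<rho> S * real (card X) powr (1 + \<alpha>)" if "X \<subseteq> V" for X
  proof (cases "X = {}")
    case True
    then show ?thesis by (simp add: adj_pairs_def)
  next
    case False
    then have "0 < card X" using that fin finite_subset card_gt_0_iff by blast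
    then show ?thesis using Smax[OF that False] by (simp add: \<rho>_def pos_divide_le_eq)
  qed
  \<comment> \<open>From \<open>k \<le> c \<le> \<rho> S \<le> m\<close>, the last because
    \<open>S\<close> has at most \<open>m * m\<close> adjacent pairs. This later lets
    \<open>m / k\<close> absorb the rounding error 1 in the part sizes.\<close>
  have "real k \<le> m"
  proof -
    have "\<rho> S * m \<le> \<rho> S * m powr (1 + \<alpha>)"
      using cS c1 m1 \<alpha> powr_mono[of 1 "1 + \<alpha>" m] by (intro mult_left_mono) auto
    also have "\<dots> \<le> m * m"
      using card_adj_pairs_le[OF finS, of E] pS unfolding m_def
      by (metis of_nat_le_iff of_nat_mult)
    finally show ?thesis using m1 cS k by simp
  qed
  define B where "B = {v \<in> S. k * D < card {b \<in> S. {v, b} \<in> E}}"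
  define A where "A = S - B"
  have finB: "finite B" and BS: "B \<subseteq> S" using finS by (auto simp: B_def)
  have cB: "card B \<le> m / k"
  proof -
    have "card B * (k * D) = (\<Sum>v\<in>B. k * D)" by simp
    also have "\<dots> \<le> (\<Sum>v\<in>B. real (card {b \<in> S. {v, b} \<in> E}))"
      by (intro sum_mono) (auto simp: B_def)
    also have "\<dots> \<le> (\<Sum>v\<in>S. real (card {b \<in> S. {v, b} \<in> E}))"
      by (intro sum_mono2 finS BS) auto
    also have "\<dots> = m * D" using card_adj_pairs[OF finS, of E] pD by (simp add: mult.commute)
    finally show ?thesis using \<open>0 < D\<close> k by (simp add: pos_le_divide_eq mult.assoc)
  qed
  txt \<open>Maximality of \<open>S\<close> bounds the number of edges inside \<open>B \<union> ?P i\<close>, a set about \<open>k\<close> times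
    smaller than \<open>S\<close>; summing over the \<open>k\<close> parts gains a factor \<open>k powr \<alpha>\<close>, so only few edges
    touch \<open>B\<close>.\<close>
  obtain f where f: "\<forall>v\<in>S. f v < k" "\<forall>i<k. card {v \<in> S. f v = i} \<le> card S div k + 1"
    using equipartition[OF finS, of k] k by auto
  let ?P = "\<lambda>i. {v \<in> S. f v = i}"
  have piece: "real (card (B \<union> ?P i)) \<le> 3 * m / k" if "i < k" for i
  proof -
    have "real (card (B \<union> ?P i)) \<le> card B + real (card (?P i))"
      using card_Un_le[of B "?P i"] by linarith
    also have "real (card (?P i)) \<le> real (card S div k + 1)" using f that by (metis of_nat_le_iff)
    also have "\<dots> \<le> m / k + 1"
      using of_int_floor_le[of "real (card S) / real k"] by (simp add: floor_divide_of_nat_eq m_def)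
    also have "1 \<le> m / k" using \<open>real k \<le> m\<close> k by simp
    finally show ?thesis using cB by simp
  qed
  have "real (card (\<Union>i<k. adj_pairs E (B \<union> ?P i))) \<le> (\<Sum>i<k. real (card (adj_pairs E (B \<union> ?P i))))"
    using card_UN_le[of "{..<k}" "\<lambda>i. adj_pairs E (B \<union> ?P i)"] by (simp flip: of_nat_sum)
  also have "\<dots> \<le> (\<Sum>i<k. \<rho> S * (3 * m / k) powr (1 + \<alpha>))"
  proof (rule sum_mono)
    fix i assume i: "i \<in> {..<k}"
    have "card (adj_pairs E (B \<union> ?P i)) \<le> \<rho> S * real (card (B \<union> ?P i)) powr (1 + \<alpha>)"
      using BS S by (intro p_le) auto
    also have "\<dots> \<le> \<rho> S * (3 * m / k) powr (1 + \<alpha>)"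
      using piece[of i] i cS c1 \<alpha> by (intro mult_left_mono powr_mono2) auto
    finally show "card (adj_pairs E (B \<union> ?P i)) \<le> \<rho> S * (3 * m / k) powr (1 + \<alpha>)" .
  qed
  also have "\<dots> = (\<rho> S * m powr (1 + \<alpha>)) * (k * (3 / k) powr (1 + \<alpha>))"
    using m1 k powr_mult[of "3 / k" m "1 + \<alpha>"] by (simp add: mult_ac)
  also have "\<dots> \<le> (\<rho> S * m powr (1 + \<alpha>)) * (1 / 4)"
  proof (rule mult_left_mono)
    \<comment> \<open>The constant 36 is chosen here: \<open>3 powr (1 + \<alpha>)\<close> is at
      most 9, and a quarter of all pairs may be lost.\<close>
    have "k * (3 / k) powr (1 + \<alpha>) = 3 powr (1 + \<alpha>) / k powr \<alpha>"
      using k by (simp add: powr_divide powr_add)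
    also have "3 powr (1 + \<alpha>) \<le> 3 powr (2::real)" using \<alpha> by (intro powr_mono) auto
    then have "3 powr (1 + \<alpha>) / k powr \<alpha> \<le> 9 / 36"
      using k by (intro frac_le) auto
    finally show "k * (3 / k) powr (1 + \<alpha>) \<le> 1 / 4" by simp
    show "0 \<le> \<rho> S * m powr (1 + \<alpha>)" using cS c1 by simp
  qed
  finally have touch: "real (card (\<Union>i<k. adj_pairs E (B \<union> ?P i))) \<le> D * m / 4"
    by (simp add: pD[unfolded pS])
  have AS: "A \<subseteq> S" and finA: "finite A" using finS by (auto simp: A_def)
  \<comment> \<open>A pair not inside \<open>A\<close> has an end in \<open>B\<close>; its other end
    lies in some part \<open>?P i\<close>, so the pair lies in
    \<open>B \<union> ?P i\<close>.\<close>
  have "adj_pairs E S \<subseteq> (\<Union>i<k. adj_pairs E (B \<union> ?P i)) \<union> adj_pairs E A"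
    using f by (auto simp: adj_pairs_def A_def)
  then have "card (adj_pairs E S) \<le> card ((\<Union>i<k. adj_pairs E (B \<union> ?P i)) \<union> adj_pairs E A)"
    using finS finB finA by (intro card_mono) (auto intro!: finite_adj_pairs)
  also have "\<dots> \<le> card (\<Union>i<k. adj_pairs E (B \<union> ?P i)) + card (adj_pairs E A)"
    by (rule card_Un_le)
  finally have pA: "3 * (D * m) / 4 \<le> card (adj_pairs E A)"
    using touch pD by linarith
  have cA: "card A \<le> m" using AS finS by (simp add: m_def card_mono)
  define d where "d = D / 2"
  define U where "U = {u \<in> A. d \<le> card {b \<in> A. {u, b} \<in> E}}"
  have UA: "U \<subseteq> A" by (auto simp: U_def)
  have degA: "card {b \<in> A. {a, b} \<in> E} \<le> k * D" if "a \<in> A" for a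
  proof -
    have "card {b \<in> A. {a, b} \<in> E} \<le> card {b \<in> S. {a, b} \<in> E}"
      using AS finS by (intro card_mono) auto
    also have "\<dots> \<le> k * D" using that by (auto simp: A_def B_def)
    finally show ?thesis by simp
  qed
  have "real (card (adj_pairs E A)) = (\<Sum>u\<in>A. real (card {b \<in> A. {u, b} \<in> E}))"
    using card_adj_pairs[OF finA, of E] by simp
  \<comment> \<open>Vertices outside \<open>U\<close> contribute at most \<open>D * m / 2\<close> of
    the remaining \<open>3 * D * m / 4\<close>. So \<open>U\<close> carries at least
    \<open>D * m / 4\<close>, with at most \<open>k * D\<close> per vertex.\<close>
  also have "\<dots> \<le> (\<Sum>u\<in>A. (if u \<in> U then k * D else 0) + d)"
    using degA \<open>0 < D\<close> by (intro sum_mono) (auto simp: U_def d_def add_increasing2)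
  also have "\<dots> = card U * (k * D) + card A * d"
    using finA UA by (simp add: sum.distrib sum.If_cases Int_absorb1)
  also have "card A * d \<le> m * d" using cA \<open>0 < D\<close> by (intro mult_right_mono) (auto simp: d_def)
  finally have "D * m \<le> D * (4 * k * card U)" using pA by (simp add: d_def algebra_simps)
  then have mU: "m \<le> 4 * real k * card U" using \<open>0 < D\<close> by simp
  have cd: "c / 2 * m powr \<alpha> \<le> d" using cS by (simp add: d_def D mult_right_mono)
  have dA: "\<forall>a\<in>A. card {b \<in> A. {a, b} \<in> E} \<le> 2 * real k * d"
    using degA by (simp add: d_def)
  have dU: "\<forall>u\<in>U. d \<le> card {b \<in> A. {u, b} \<in> E}"
    by (simp add: U_def)
  show thesis by (rule that[OF subset_trans[OF AS S(1)] UA m1 cd cA mU dA dU])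
qed

section \<open>Choice of constants and the bound on \<open>ex\<close>\<close>

lemma dense_contains_H:
  fixes t :: nat
  assumes "t \<ge> 3"
  shows "\<exists>C :: real. \<forall>(V :: 'a set) E. finite V \<longrightarrow> V \<noteq> {} \<longrightarrow>
    C * real (card V) powr (1 + (real t - 2) / (2 * real t - 3)) \<le> card (adj_pairs E V) \<longrightarrow>
    contains_subgraph (V, E) (H t)"
proof -
  define \<alpha> where "\<alpha> = (real t - 2) / (2 * real t - 3)"
  have t3: "3 \<le> real t" using assms by simp
  have \<alpha>: "0 < \<alpha>" "\<alpha> \<le> 1" using t3 by (simp_all add: \<alpha>_def)
  define k where "k = nat \<lceil>36 powr (1 / \<alpha>)\<rceil>"
  have k36: "36 powr (1 / \<alpha>) \<le> real k" by (simp add: k_def)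
  have k1: "1 \<le> k" using k36 ge_one_powr_ge_zero[of 36 "1 / \<alpha>"] \<alpha> by simp
  have "36 = (36 powr (1 / \<alpha>)) powr \<alpha>" using \<alpha> by (simp add: powr_powr)
  also have "\<dots> \<le> real k powr \<alpha>" using k36 \<alpha> by (intro powr_mono2) auto
  finally have k\<alpha>: "36 \<le> real k powr \<alpha>" .
  \<comment> \<open>\<open>K\<close> is the product of \<open>4 * k\<close>, lost in passing from
    \<open>m\<close> to \<open>card U\<close>, and the factor \<open>4 * t ^ 6 * (2 * k)\<close> of
    \<open>large\<close>. \<open>W\<close> cancels the constant in
    \<open>\<gamma> ^ (t - 2)\<close>, and the 2 in \<open>C\<close> makes up for
    \<open>c / 2\<close> in \<open>almost_regular_part\<close>.\<close>
  define K where "K = 32 * (real k)\<^sup>2 * real t ^ 6"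
  define W where "W = (4 * real t ^ 3) ^ (t - 2)"
  define C where "C = 2 * (K * W)"
  have kk: "real k \<le> (real k)\<^sup>2" using k1 by (simp add: power2_eq_square)
  have "1 \<le> real t ^ 3" using t3 by (intro one_le_power) simp
  then have W1: "1 \<le> W" unfolding W_def by (intro one_le_power) simp
  have kK: "real k \<le> K"
  proof -
    have "1 \<le> real t ^ 6" using t3 by (intro one_le_power) simp
    moreover have "real k \<le> 32 * (real k)\<^sup>2" using kk by linarith
    ultimately have "real k * 1 \<le> (32 * (real k)\<^sup>2) * real t ^ 6" by (intro mult_mono) auto
    then show ?thesis by (simp add: K_def)
  qed
  have K1: "1 \<le> K" using kK k1 by linarith
  have KW: "K \<le> K * W" using W1 K1 by simp
  have kC: "real k \<le> C" using kK KW K1 unfolding C_def by linarith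
  have "contains_subgraph (V, E) (H t)"
    if V: "finite V" "V \<noteq> {}" and dense: "C * real (card V) powr (1 + \<alpha>) \<le> card (adj_pairs E V)"
    for V :: "'a set" and E
  proof (rule ccontr)
    assume noH: "\<not> contains_subgraph (V, E) (H t)"
    obtain A U and m d :: real where A: "A \<subseteq> V" "U \<subseteq> A" "1 \<le> m" and d: "C / 2 * m powr \<alpha> \<le> d"
      and m: "card A \<le> m" "m \<le> 4 * real k * card U"
      and deg_le: "\<forall>a\<in>A. card {b \<in> A. {a, b} \<in> E} \<le> 2 * real k * d"
      and deg_ge: "\<forall>u\<in>U. d \<le> card {b \<in> A. {u, b} \<in> E}"
      by (rule almost_regular_part[OF V \<alpha> k1 k\<alpha> kC dense])
    have finA: "finite A" using A V finite_subset by blast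
    have "1 \<le> m powr \<alpha>" using A(3) \<alpha> by (simp add: ge_one_powr_ge_zero)
    have KWd: "K * W * m powr \<alpha> \<le> d" using d by (simp add: C_def)
    moreover have "K * W * 1 \<le> K * W * m powr \<alpha>"
      using \<open>1 \<le> m powr \<alpha>\<close> K1 W1 by (intro mult_left_mono) auto
    ultimately have Kd: "K \<le> d" using KW by linarith
    then have "0 < d" using K1 by linarith
    define \<gamma> where "\<gamma> = d\<^sup>2 / (4 * real t ^ 3 * m)"
    have "0 < \<gamma>" using \<open>0 < d\<close> A(3) t3 by (simp add: \<gamma>_def)
    \<comment> \<open>The exponent is used here: \<open>\<gamma> ^ (t - 2) * d\<close> equals
      \<open>d ^ (2 * t - 3) / (W * m ^ (t - 2))\<close>, and
      \<open>\<alpha> * (2 * t - 3) = t - 2\<close> makes the powers of \<open>m\<close>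
      cancel.\<close>
    have top: "K \<le> \<gamma> ^ (t - 2) * d"
    proof -
      have "1 \<le> K * W" using KW K1 by linarith
      have e: "2 * (t - 2) + 1 = 2 * t - 3" "real (2 * t - 3) = 2 * real t - 3" using assms by auto
      have "(m powr \<alpha>) ^ (2 * t - 3) = m powr (\<alpha> * real (2 * t - 3))"
        using A(3) by (simp add: powr_power mult.commute)
      also have "\<alpha> * real (2 * t - 3) = real (t - 2)" using e t3 assms by (simp add: \<alpha>_def)
      also have "m powr real (t - 2) = m ^ (t - 2)" using A(3) by (simp add: powr_realpow)
      finally have mp: "(m powr \<alpha>) ^ (2 * t - 3) = m ^ (t - 2)" .
      have "K * W * m ^ (t - 2) \<le> (K * W) ^ (2 * t - 3) * m ^ (t - 2)"
        using self_le_power[OF \<open>1 \<le> K * W\<close>, of "2 * t - 3"] assms A(3)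
        by (intro mult_right_mono) auto
      also have "\<dots> = (K * W * m powr \<alpha>) ^ (2 * t - 3)" by (simp add: power_mult_distrib mp)
      also have "\<dots> \<le> d ^ (2 * t - 3)"
        using KWd K1 W1 by (intro power_mono) auto
      also have "\<dots> = (d\<^sup>2) ^ (t - 2) * d" unfolding e(1)[symmetric] by (simp add: power_mult)
      finally have "K * (W * m ^ (t - 2)) \<le> (d\<^sup>2) ^ (t - 2) * d" by (simp add: mult.assoc)
      moreover have "\<gamma> ^ (t - 2) * d = (d\<^sup>2) ^ (t - 2) * d / (W * m ^ (t - 2))"
        by (simp add: \<gamma>_def W_def power_divide power_mult_distrib)
      moreover have "0 < W * m ^ (t - 2)" using W1 A(3) by simp
      ultimately show ?thesis by (simp add: pos_le_divide_eq)
    qed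
    have large: "4 * real t ^ 6 * (2 * real k) * m / d \<le> \<gamma> ^ s * card U" if "s + 2 \<le> t" for s
    proof -
      \<comment> \<open>As \<open>\<gamma>\<close> may lie on either side of 1, the critical case is
        \<open>s = 0\<close>, covered by \<open>Kd\<close>, or \<open>s = t - 2\<close>, covered by
        \<open>top\<close>.\<close>
      have "K \<le> \<gamma> ^ s * d"
      proof (cases "1 \<le> \<gamma>")
        case True
        then have "1 * d \<le> \<gamma> ^ s * d" using \<open>0 < d\<close> by (intro mult_right_mono) auto
        then show ?thesis using Kd by linarith
      next
        case False
        then have "\<gamma> ^ (t - 2) \<le> \<gamma> ^ s" using that \<open>0 < \<gamma>\<close> by (intro power_decreasing) auto
        then have "\<gamma> ^ (t - 2) * d \<le> \<gamma> ^ s * d" using \<open>0 < d\<close> by (intro mult_right_mono) auto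
        then show ?thesis using top by linarith
      qed
      then have "K * m \<le> (\<gamma> ^ s * d) * (4 * real k * card U)"
        using m(2) \<open>0 < \<gamma>\<close> \<open>0 < d\<close> A(3) by (intro mult_mono) auto
      then have "(4 * real k) * (4 * real t ^ 6 * (2 * real k) * m) \<le> (4 * real k) * (\<gamma> ^ s * card U * d)"
        by (simp add: K_def power2_eq_square mult_ac)
      then have "4 * real t ^ 6 * (2 * real k) * m \<le> \<gamma> ^ s * card U * d"
        using k1 by (simp only: mult_le_cancel_left_pos)
      then show ?thesis using \<open>0 < d\<close> by (simp add: pos_divide_le_eq)
    qed
    have clique: "card T \<le> t"
      if T: "T \<subseteq> A" "\<And>x y. x \<in> T \<Longrightarrow> y \<in> T \<Longrightarrow> x \<noteq> y \<Longrightarrow> heavy E A (t ^ 2) x y" for T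
    proof (rule ccontr)
      assume "\<not> card T \<le> t"
      then obtain T' where T': "T' \<subseteq> T" "card T' = t" by (meson nat_le_linear obtain_subset_with_card_n)
      have "contains_subgraph (V, E) (H t)"
        using T T' by (intro contains_H_if_heavy_clique[OF finA A(1) _ T'(2)]) auto
      then show False using noH by simp
    qed
    have "U \<noteq> {}" using m(2) A(3) by auto
    have "1 \<le> t" "1 \<le> 2 * real k" "0 < m" using assms k1 A(3) by auto
    then obtain T where "T \<subseteq> A" "card T = t" "spread E A (t ^ 2) T"
      using spread_set_exists[OF finA A(2) \<open>U \<noteq> {}\<close> _ \<open>0 < d\<close> _ m(1) _ bspec[OF deg_ge] bspec[OF deg_le] clique \<gamma>_def large]
      by blast
    then show False using contains_H_if_spread[OF finA A(1)] noH by blast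
  qed
  then show ?thesis unfolding \<alpha>_def by blast
qed

theorem theorem3:
  fixes t :: nat
  assumes "t \<ge> 3"
  shows "\<exists>C :: real. \<forall>n :: nat. n \<ge> 1 \<longrightarrow>
           real (ex n (H t)) \<le> C * real n powr (1 + (real t - 2) / (2 * real t - 3))"
proof -
  obtain C :: real where C: "\<And>(V :: nat set) E. finite V \<Longrightarrow> V \<noteq> {} \<Longrightarrow>
      C * real (card V) powr (1 + (real t - 2) / (2 * real t - 3)) \<le> card (adj_pairs E V) \<Longrightarrow>
      contains_subgraph (V, E) (H t)"
    using dense_contains_H[OF assms, where 'a = nat] by blast
  have "real (ex n (H t)) \<le> C * real n powr (1 + (real t - 2) / (2 * real t - 3))"
    (is "_ \<le> ?b") if n: "n \<ge> 1" for n
  proof -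
    let ?X = "{card (snd G) | G :: nat graph.
              fst G = {0..<n} \<and> simple_graph G \<and> \<not> contains_subgraph G (H t)}"
    have le: "real x \<le> ?b" if "x \<in> ?X" for x
    proof -
      from that obtain E where x: "x = card E" and simple: "simple_graph ({0..<n}, E)"
        and free: "\<not> contains_subgraph ({0..<n}, E) (H t)" by auto
      \<comment> \<open>Each edge comes from some ordered pair; the factor 2 that could be gained is
        dropped.\<close>
      have "E \<subseteq> (\<lambda>(u, v). {u, v}) ` adj_pairs E {0..<n}"
      proof
        fix e assume e: "e \<in> E"
        then obtain u v where "u \<in> {0..<n}" "v \<in> {0..<n}" "e = {u, v}"
          using simple by (auto simp: simple_graph_def)
        then show "e \<in> (\<lambda>(u, v). {u, v}) ` adj_pairs E {0..<n}"
          using e by (intro image_eqI[of _ _ "(u, v)"]) (auto simp: adj_pairs_def)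
      qed
      then have "card E \<le> card (adj_pairs E {0..<n})"
        by (simp add: finite_adj_pairs surj_card_le)
      moreover have "\<not> ?b \<le> card (adj_pairs E {0..<n})"
        using C[of "{0..<n}" E] free n by auto
      ultimately show ?thesis using x by linarith
    qed
    \<comment> \<open>\<open>Max\<close> is only meaningful on a finite nonempty set. Finiteness
      follows from the bound \<open>le\<close> itself.\<close>
    have "finite ?X"
    proof (rule finite_subset)
      show "?X \<subseteq> {..nat \<lfloor>?b\<rfloor>}" using le le_nat_floor by blast
    qed simp
    \<comment> \<open>The edgeless graph is a witness for every \<open>n\<close>, since
      \<open>H t\<close> has at least one edge.\<close>
    moreover have "?X \<noteq> {}"
    proof -
      have "{0, 1} \<in> snd (complete_graph t)"
        using assms unfolding complete_graph_def snd_conv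
        by (intro CollectI exI[of _ "0 :: nat"] exI[of _ "1 :: nat"]) simp
      moreover have "0 \<in> fst (complete_graph t)" using assms by (simp add: complete_graph_def)
      ultimately have "{Inl 0, Inr {0, 1}} \<in> snd (H t)"
        unfolding H_def subdivision_def snd_conv by blast
      then have "\<not> contains_subgraph ({0..<n}, {}) (H t)"
        by (auto simp: contains_subgraph_def)
      moreover have "simple_graph ({0..<n}, {} :: nat set set)" by (simp add: simple_graph_def)
      ultimately have "card (snd ({0..<n}, {} :: nat set set)) \<in> ?X" by force
      then show ?thesis by blast
    qed
    ultimately have "ex n (H t) \<in> ?X" unfolding ex_def by (rule Max_in)
    then show ?thesis by (rule le)
  qed
  then show ?thesis by blast
qed

end
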